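(* Let $0<\alpha\le 1$ and let $n$ be a natural number. The solution, obtained by means of the conformable Laplace transform with $y(0)=1$, of the conformable Laguerre differential equation $$x^\alpha D^\alpha D^\alpha y+(\alpha-x^\alpha)D^\alpha y+n\alpha\, y=0$$ takes the form $$y(x)=\sum_{k=0}^n (-1)^k \frac{n!}{\alpha^k\,(n-k)!\,(k!)^2}\,x^{k\alpha}.$$
   Context: For $0<\alpha\le 1$, the conformable derivative of order $\alpha$ of a function $f:[0,\infty)\to\mathbb{R}$ is $D^\alpha f(x)=\lim_{\epsilon\to 0}\frac{f(x+\epsilon x^{1-\alpha})-f(x)}{\epsilon}$, and $D^\alpha D^\alpha y$ denotes $D^\alpha$ applied twice in succession. The conformable Laplace transform of order $\alpha$ of $f:[0,\infty)\to\mathbb{R}$ is $\mathcal{L}_\alpha[f](s)=\int_0^\infty e^{-s x^\alpha/\alpha} f(x)\,x^{\alpha-1}\,dx$. The solution is obtained by applying $\mathcal{L}_\alpha$ to the equation, solving for $Y_\alpha(s)=\mathcal{L}_\alpha[y](s)$, and applying the inverse transform. *)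

theory Defs
  imports "HOL-Analysis.Analysis"
begin

text \<open>Functions on \<open>[0, \<infinity>)\<close> are total functions on the reals of which only the values on
  \<open>[0, \<infinity>)\<close> matter. The conformable derivative is only used at points \<open>x > 0\<close>, where
  \<open>x + \<epsilon> * x powr (1 - \<alpha>) > 0\<close> for all small \<open>\<epsilon>\<close>.\<close>

definition conf_differentiable :: "real \<Rightarrow> (real \<Rightarrow> real) \<Rightarrow> real \<Rightarrow> bool" where
  "conf_differentiable \<alpha> f x \<longleftrightarrow>
     (\<exists>l. ((\<lambda>\<epsilon>. (f (x + \<epsilon> * x powr (1 - \<alpha>)) - f x) / \<epsilon>) \<longlongrightarrow> l) (at 0))"

definition conf_deriv :: "real \<Rightarrow> (real \<Rightarrow> real) \<Rightarrow> real \<Rightarrow> real" where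
  "conf_deriv \<alpha> f x = Lim (at 0) (\<lambda>\<epsilon>. (f (x + \<epsilon> * x powr (1 - \<alpha>)) - f x) / \<epsilon>)"

text \<open>The gauge integral over \<open>[0, \<infinity>)\<close> also covers conditionally convergent improper integrals.\<close>

definition conf_laplace_exists :: "real \<Rightarrow> (real \<Rightarrow> real) \<Rightarrow> real \<Rightarrow> bool" where
  "conf_laplace_exists \<alpha> f s \<longleftrightarrow>
     (\<lambda>x. exp (- s * x powr \<alpha> / \<alpha>) * f x * x powr (\<alpha> - 1)) integrable_on {0..}"

definition conf_laplace :: "real \<Rightarrow> (real \<Rightarrow> real) \<Rightarrow> real \<Rightarrow> real" where
  "conf_laplace \<alpha> f s =
     integral {0..} (\<lambda>x. exp (- s * x powr \<alpha> / \<alpha>) * f x * x powr (\<alpha> - 1))"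

text \<open>The equation is imposed for \<open>x > 0\<close>: at \<open>x = 0\<close> and \<open>\<alpha> < 1\<close> the limit defining the
  conformable derivative is \<open>0\<close> for every function. Continuity on \<open>[0, \<infinity>)\<close> is what ties the
  initial value \<open>y 0\<close> to the solution on \<open>(0, \<infinity>)\<close>.\<close>

definition conf_laguerre_solution :: "real \<Rightarrow> nat \<Rightarrow> (real \<Rightarrow> real) \<Rightarrow> bool" where
  "conf_laguerre_solution \<alpha> n y \<longleftrightarrow>
     continuous_on {0..} y \<and>
     (\<forall>x>0. conf_differentiable \<alpha> y x \<and> conf_differentiable \<alpha> (conf_deriv \<alpha> y) x \<and>
        x powr \<alpha> * conf_deriv \<alpha> (conf_deriv \<alpha> y) x + (\<alpha> - x powr \<alpha>) * conf_deriv \<alpha> y x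
          + real n * \<alpha> * y x = 0)"

text \<open>The transform method applies to \<open>y\<close>: for all large \<open>s\<close> every term of the equation has a
  conformable Laplace transform, and the transformed equation holds.\<close>

definition conf_laguerre_transformed :: "real \<Rightarrow> nat \<Rightarrow> (real \<Rightarrow> real) \<Rightarrow> bool" where
  "conf_laguerre_transformed \<alpha> n y \<longleftrightarrow>
     (\<exists>s\<^sub>0. \<forall>s>s\<^sub>0.
        conf_laplace_exists \<alpha> y s \<and>
        conf_laplace_exists \<alpha> (\<lambda>x. (\<alpha> - x powr \<alpha>) * conf_deriv \<alpha> y x) s \<and>
        conf_laplace_exists \<alpha> (\<lambda>x. x powr \<alpha> * conf_deriv \<alpha> (conf_deriv \<alpha> y) x) s \<and>
        conf_laplace \<alpha> (\<lambda>x. x powr \<alpha> * conf_deriv \<alpha> (conf_deriv \<alpha> y) x) s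
          + conf_laplace \<alpha> (\<lambda>x. (\<alpha> - x powr \<alpha>) * conf_deriv \<alpha> y x) s
          + real n * \<alpha> * conf_laplace \<alpha> y s = 0)"

end

theory Submission
  imports Defs "HOL-Computational_Algebra.Polynomial"
begin

text \<open>The substitution \<open>t = x powr \<alpha> / \<alpha>\<close> turns the conformable derivative into the ordinary one
  and the equation into Laguerre's equation \<open>t u'' + (1 - t) u' + n u = 0\<close>. Continuity at \<open>0\<close>
  excludes the logarithmic second solution, so near \<open>0\<close> a solution with value \<open>1\<close> at \<open>0\<close> is the
  Laguerre polynomial, and a Gronwall estimate for \<open>w\<^sup>2 + w'\<^sup>2\<close> propagates the equality to all
  \<open>t > 0\<close>. Conversely, polynomials in \<open>t\<close> have conformable Laplace transforms for all \<open>s > 0\<close>, and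
  integrating the equation termwise yields the transformed one.\<close>

section \<open>Conformable derivatives as ordinary derivatives; change of variable\<close>

text \<open>At a fixed point the increment is merely rescaled by the positive constant
  \<open>x powr (1 - \<alpha>)\<close>, so the quotient is an ordinary difference quotient along an
  affine reparametrisation.\<close>

lemma conf_quotient_tendsto_iff:
  fixes f :: "real \<Rightarrow> real"
  assumes "x > 0"
  shows "((\<lambda>\<epsilon>. (f (x + \<epsilon> * x powr (1 - \<alpha>)) - f x) / \<epsilon>) \<longlongrightarrow> l) (at 0) \<longleftrightarrow>
    (f has_real_derivative l * x powr (\<alpha> - 1)) (at x)"
proof -
  define c where "c = x powr (1 - \<alpha>)"
  have c: "c > 0" "x powr (\<alpha> - 1) = 1 / c"
    using assms by (simp_all add: c_def powr_minus_divide[symmetric])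
  have "((\<lambda>\<epsilon>. (f (x + \<epsilon> * c) - f x) / \<epsilon>) \<longlongrightarrow> l) (at 0) \<longleftrightarrow>
      ((\<lambda>\<epsilon>. f (x + \<epsilon> * c)) has_real_derivative l) (at 0)"
    by (simp add: DERIV_def)
  also have "\<dots> \<longleftrightarrow> (f has_real_derivative l / c) (at x)"
  proof
    assume *: "((\<lambda>\<epsilon>. f (x + \<epsilon> * c)) has_real_derivative l) (at 0)"
    \<comment> \<open>Composing with the inverse affine map \<open>(z - x) / c\<close> recovers
      \<open>f\<close> itself.\<close>
    have "((\<lambda>z. f (x + ((z - x) / c) * c)) has_real_derivative l * (1 / c)) (at x)"
      by (rule DERIV_chain2[of "\<lambda>\<epsilon>. f (x + \<epsilon> * c)"])
        (use * c in \<open>auto intro!: derivative_eq_intros\<close>)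
    then show "(f has_real_derivative l / c) (at x)"
      using c by simp
  next
    assume *: "(f has_real_derivative l / c) (at x)"
    have "((\<lambda>\<epsilon>. f (x + \<epsilon> * c)) has_real_derivative (l / c) * c) (at 0)"
      by (rule DERIV_chain2[of f]) (use * in \<open>auto intro!: derivative_eq_intros\<close>)
    then show "((\<lambda>\<epsilon>. f (x + \<epsilon> * c)) has_real_derivative l) (at 0)"
      using c by simp
  qed
  finally show ?thesis
    by (simp add: c_def[symmetric] c(2))
qed

lemma conf_differentiable_imp_has_real_derivative:
  assumes "x > 0" "conf_differentiable \<alpha> f x"
  shows "(f has_real_derivative conf_deriv \<alpha> f x * x powr (\<alpha> - 1)) (at x)"
proof -
  obtain l where l: "((\<lambda>\<epsilon>. (f (x + \<epsilon> * x powr (1 - \<alpha>)) - f x) / \<epsilon>) \<longlongrightarrow> l) (at 0)"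
    using assms(2) by (auto simp: conf_differentiable_def)
  then have "conf_deriv \<alpha> f x = l"
    unfolding conf_deriv_def by (intro tendsto_Lim) auto
  with l show ?thesis
    by (simp add: conf_quotient_tendsto_iff[OF assms(1)])
qed

lemma conf_deriv_eqI:
  assumes "x > 0" "(f has_real_derivative l * x powr (\<alpha> - 1)) (at x)"
  shows "conf_differentiable \<alpha> f x" "conf_deriv \<alpha> f x = l"
proof -
  have l: "((\<lambda>\<epsilon>. (f (x + \<epsilon> * x powr (1 - \<alpha>)) - f x) / \<epsilon>) \<longlongrightarrow> l) (at 0)"
    using assms by (simp add: conf_quotient_tendsto_iff)
  then show "conf_differentiable \<alpha> f x" by (auto simp: conf_differentiable_def)
  show "conf_deriv \<alpha> f x = l"
    unfolding conf_deriv_def using l by (intro tendsto_Lim) auto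
qed

text \<open>The inner function \<open>z powr \<alpha> / \<alpha>\<close> has derivative
  \<open>z powr (\<alpha> - 1)\<close>, exactly the factor between the ordinary and the conformable
  derivative. Hence the latter is differentiation in
  \<open>t = x powr \<alpha> / \<alpha>\<close>.\<close>

lemma conf_deriv_of_powr_function:
  assumes "\<alpha> > 0" "x > 0" and u: "(u has_real_derivative l) (at (x powr \<alpha> / \<alpha>))"
    and eq: "\<And>z. z > 0 \<Longrightarrow> f z = u (z powr \<alpha> / \<alpha>)"
  shows "conf_differentiable \<alpha> f x" "conf_deriv \<alpha> f x = l"
proof -
  have "((\<lambda>z. u (z powr \<alpha> / \<alpha>)) has_real_derivative l * x powr (\<alpha> - 1)) (at x)"
    by (rule DERIV_chain2[of u])
      (use assms in \<open>auto intro!: derivative_eq_intros has_real_derivative_powr\<close>)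
  then have "(f has_real_derivative l * x powr (\<alpha> - 1)) (at x)"
    by (rule has_field_derivative_transform_within_open[of _ _ _ "{0<..}"])
      (use assms in auto)
  then show "conf_differentiable \<alpha> f x" "conf_deriv \<alpha> f x = l"
    using conf_deriv_eqI[OF \<open>x > 0\<close>] by auto
qed

text \<open>The same change of variable read backwards:
  \<open>(\<alpha> * t) powr (1 / \<alpha>)\<close> inverts
  \<open>x powr \<alpha> / \<alpha>\<close> on positive arguments.\<close>

lemma has_real_derivative_compose_powr_inverse:
  assumes "\<alpha> > 0" "t > 0" and "conf_differentiable \<alpha> f ((\<alpha> * t) powr (1 / \<alpha>))"
  shows "((\<lambda>t. f ((\<alpha> * t) powr (1 / \<alpha>))) has_real_derivative
    conf_deriv \<alpha> f ((\<alpha> * t) powr (1 / \<alpha>))) (at t)"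
proof -
  define x where "x = (\<alpha> * t) powr (1 / \<alpha>)"
  have x: "x > 0" using assms by (simp add: x_def)
  \<comment> \<open>The exponents of \<open>\<alpha> * t\<close> are \<open>1 - 1 / \<alpha>\<close>
    and \<open>1 / \<alpha> - 1\<close>, so the two chain rule factors cancel.\<close>
  have e: "x powr (\<alpha> - 1) * (\<alpha> * t) powr (1 / \<alpha> - 1) = 1"
    using assms by (simp add: x_def powr_powr powr_add[symmetric] field_simps)
  have "((\<lambda>t. f ((\<alpha> * t) powr (1 / \<alpha>))) has_real_derivative
      (conf_deriv \<alpha> f x * x powr (\<alpha> - 1)) * ((\<alpha> * t) powr (1 / \<alpha> - 1))) (at t)"
  proof (rule DERIV_chain2[of f])
    show "(f has_real_derivative conf_deriv \<alpha> f x * x powr (\<alpha> - 1)) (at ((\<alpha> * t) powr (1 / \<alpha>)))"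
      using conf_differentiable_imp_has_real_derivative[OF x] assms(3) by (simp add: x_def)
    show "((\<lambda>t. (\<alpha> * t) powr (1 / \<alpha>)) has_real_derivative (\<alpha> * t) powr (1 / \<alpha> - 1)) (at t)"
      using assms by (auto intro!: derivative_eq_intros simp: powr_diff)
  qed
  then show ?thesis
    using e by (simp add: mult.assoc x_def[symmetric])
qed

section \<open>Uniqueness of the regular solution of Laguerre's equation\<close>

text \<open>Abel's formula makes \<open>t * exp (- t)\<close> times the Wronskian constant. Were that constant
  nonzero, \<open>(u / v)'\<close> would behave like \<open>1 / t\<close>, so \<open>u / v\<close> would change by a fixed amount
  between \<open>t\<close> and \<open>2 * t\<close> for all small \<open>t\<close>.\<close>

lemma laguerre_eq_near_0:
  fixes u v u' v' u'' v'' :: "real \<Rightarrow> real" and \<nu> c :: real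
  assumes u: "\<And>t. t > 0 \<Longrightarrow> (u has_real_derivative u' t) (at t)"
      "\<And>t. t > 0 \<Longrightarrow> (u' has_real_derivative u'' t) (at t)"
      "\<And>t. t > 0 \<Longrightarrow> t * u'' t + (1 - t) * u' t + \<nu> * u t = 0"
    and v: "\<And>t. t > 0 \<Longrightarrow> (v has_real_derivative v' t) (at t)"
      "\<And>t. t > 0 \<Longrightarrow> (v' has_real_derivative v'' t) (at t)"
      "\<And>t. t > 0 \<Longrightarrow> t * v'' t + (1 - t) * v' t + \<nu> * v t = 0"
    and lim: "(u \<longlongrightarrow> c) (at_right 0)" "(v \<longlongrightarrow> c) (at_right 0)" "c \<noteq> 0"
  shows "\<exists>\<delta>>0. \<forall>t. 0 < t \<longrightarrow> t < \<delta> \<longrightarrow> u t = v t"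
proof -
  define W where "W t = t * exp (- t) * (u t * v' t - u' t * v t)" for t
  have "(W has_real_derivative 0) (at t within {0<..})" if "t > 0" for t
  proof -
    \<comment> \<open>The products \<open>u' t * v' t\<close> cancel. The equation turns the two
      brackets into \<open>- \<nu> * v t\<close> and \<open>- \<nu> * u t\<close>, and the
      difference vanishes.\<close>
    have "(W has_real_derivative
        exp (- t) * (u t * (t * v'' t + (1 - t) * v' t) - v t * (t * u'' t + (1 - t) * u' t))) (at t)"
      unfolding W_def
      by (rule derivative_eq_intros refl u v that)+ (simp add: algebra_simps)
    also have "t * v'' t + (1 - t) * v' t = - \<nu> * v t"
      using v(3)[OF that] by linarith
    also have "t * u'' t + (1 - t) * u' t = - \<nu> * u t"
      using u(3)[OF that] by linarith
    finally show ?thesis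
      by (simp add: has_field_derivative_at_within)
  qed
  then obtain C where C: "\<And>t. t > 0 \<Longrightarrow> W t = C"
    using has_field_derivative_zero_constant[of "{0<..}" W] by auto
  have "\<forall>\<^sub>F t in at_right 0. v t \<noteq> 0"
    using lim by (intro tendsto_imp_eventually_ne) auto
  moreover have "\<forall>\<^sub>F t in at_right 0. \<bar>v t\<bar> < 2 * \<bar>c\<bar>"
    using lim by (intro order_tendstoD(2)[OF tendsto_rabs]) auto
  ultimately have "\<forall>\<^sub>F t in at_right 0. v t \<noteq> 0 \<and> \<bar>v t\<bar> < 2 * \<bar>c\<bar>"
    by (rule eventually_conj)
  then obtain \<delta> where \<delta>: "\<delta> > 0"
      "\<And>t. 0 < t \<Longrightarrow> t < \<delta> \<Longrightarrow> v t \<noteq> 0 \<and> \<bar>v t\<bar> < 2 * \<bar>c\<bar>"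
    unfolding eventually_at_right_field by auto
  define g where "g t = u t / v t" for t
  have g: "(g has_real_derivative - C * exp t / (t * (v t)\<^sup>2)) (at t)" if "0 < t" "t < \<delta>" for t
  proof -
    have nz: "v t \<noteq> 0" using \<delta> that by auto
    have "(g has_real_derivative (u' t * v t - u t * v' t) / (v t)\<^sup>2) (at t)"
      unfolding g_def
      by (rule derivative_eq_intros refl u v that nz)+ (simp add: power2_eq_square)
    also have "u' t * v t - u t * v' t = - C * exp t / t"
      using C[OF that(1)] that by (simp add: W_def exp_minus field_simps)
    finally show ?thesis by simp
  qed
  have glim: "(g \<longlongrightarrow> 1) (at_right 0)"
    unfolding g_def using tendsto_divide[OF lim] lim(3) by simp
  have "C = 0"
  proof (rule ccontr)
    assume "C \<noteq> 0"
    \<comment> \<open>Lower bound from the mean value theorem on \<open>[t, 2 * t]\<close>: the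
      length is \<open>t\<close>, and the intermediate point satisfies \<open>\<xi> < 2 * t\<close>,
      \<open>exp \<xi> \<ge> 1\<close> and \<open>\<bar>v \<xi>\<bar> < 2 * \<bar>c\<bar>\<close>;
      the factor \<open>t\<close> cancels.\<close>
    define m where "m = \<bar>C\<bar> / (2 * (2 * \<bar>c\<bar>)\<^sup>2)"
    have m: "m > 0" using \<open>C \<noteq> 0\<close> lim(3) by (simp add: m_def)
    have "((\<lambda>t. g (2 * t)) \<longlongrightarrow> 1) (at_right 0)"
      by (rule filterlim_compose[OF glim])
        (auto simp: filterlim_at eventually_at_right_field intro!: tendsto_eq_intros exI[of _ 1])
    then have "((\<lambda>t. \<bar>g (2 * t) - g t\<bar>) \<longlongrightarrow> \<bar>1 - 1\<bar>) (at_right 0)"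
      by (intro tendsto_intros glim)
    then have "\<forall>\<^sub>F t in at_right 0. \<bar>g (2 * t) - g t\<bar> < m"
      using m by (intro order_tendstoD(2)) auto
    then obtain d where d: "d > 0" "\<And>t. 0 < t \<Longrightarrow> t < d \<Longrightarrow> \<bar>g (2 * t) - g t\<bar> < m"
      unfolding eventually_at_right_field by auto
    define t where "t = min d \<delta> / 4"
    have t: "0 < t" "t < d" "2 * t < \<delta>" using d \<delta> by (auto simp: t_def)
    obtain \<xi> where \<xi>: "t < \<xi>" "\<xi> < 2 * t"
        "g (2 * t) - g t = (2 * t - t) * (- C * exp \<xi> / (\<xi> * (v \<xi>)\<^sup>2))"
      using MVT2[of t "2 * t" g "\<lambda>t. - C * exp t / (t * (v t)\<^sup>2)"] g t by force
    have v\<xi>: "v \<xi> \<noteq> 0" "\<bar>v \<xi>\<bar> < 2 * \<bar>c\<bar>" using \<delta>(2)[of \<xi>] \<xi> t by auto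
    have "(v \<xi>)\<^sup>2 \<le> (2 * \<bar>c\<bar>)\<^sup>2"
      using v\<xi>(2) by (intro power2_le_iff_abs_le[THEN iffD2]) auto
    then have "\<xi> * (v \<xi>)\<^sup>2 \<le> (2 * t) * (2 * \<bar>c\<bar>)\<^sup>2"
      using \<xi> t by (intro mult_mono) auto
    moreover have "\<xi> * (v \<xi>)\<^sup>2 > 0" using v\<xi> \<xi> t by auto
    moreover have "t * \<bar>C\<bar> * 1 \<le> t * \<bar>C\<bar> * exp \<xi>"
      using \<xi> t by (intro mult_left_mono) auto
    ultimately have "t * \<bar>C\<bar> * 1 / ((2 * t) * (2 * \<bar>c\<bar>)\<^sup>2) \<le> t * \<bar>C\<bar> * exp \<xi> / (\<xi> * (v \<xi>)\<^sup>2)"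
      using t by (intro frac_le) auto
    also have "\<dots> = \<bar>g (2 * t) - g t\<bar>"
      using \<xi> t by (simp add: abs_mult)
    also have "\<dots> < m" using d t by auto
    finally show False using t by (simp add: m_def)
  qed
  \<comment> \<open>With a vanishing Wronskian the quotient is constant near 0, and the common
    nonzero limit of \<open>u\<close> and \<open>v\<close> forces the constant to be 1.\<close>
  have "(g has_real_derivative 0) (at t within {0<..<\<delta>})" if "t \<in> {0<..<\<delta>}" for t
    using g[of t] that \<open>C = 0\<close> by (simp add: has_field_derivative_at_within)
  then obtain k where k: "\<And>t. 0 < t \<Longrightarrow> t < \<delta> \<Longrightarrow> g t = k"
    using has_field_derivative_zero_constant[of "{0<..<\<delta>}" g] by auto
  have "(g \<longlongrightarrow> k) (at_right 0)"
    by (rule tendsto_eventually) (use k \<delta> in \<open>auto simp: eventually_at_right_field\<close>)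
  then have "k = 1"
    using glim by (rule tendsto_unique[OF trivial_limit_at_right_real])
  with k \<delta> have "u t = v t" if "0 < t" "t < \<delta>" for t
    using that by (force simp: g_def)
  with \<delta>(1) show ?thesis by blast
qed

text \<open>Gronwall's argument: on \<open>[a, \<infinity>)\<close> the energy \<open>E\<close>
  satisfies \<open>E' \<le> K * E\<close>, so \<open>E t * exp (- K * t)\<close> is nonincreasing.
  It starts at 0 and \<open>E\<close> is nonnegative. Starting at \<open>a > 0\<close> keeps
  \<open>\<nu> / t\<close> bounded.\<close>

lemma laguerre_zero_continuation:
  fixes w w' w'' :: "real \<Rightarrow> real" and \<nu> a :: real
  assumes w: "\<And>t. t > 0 \<Longrightarrow> (w has_real_derivative w' t) (at t)"
      "\<And>t. t > 0 \<Longrightarrow> (w' has_real_derivative w'' t) (at t)"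
      "\<And>t. t > 0 \<Longrightarrow> t * w'' t + (1 - t) * w' t + \<nu> * w t = 0"
    and a: "a > 0" "w a = 0" "w' a = 0" and "a \<le> T"
  shows "w T = 0"
proof -
  \<comment> \<open>The three contributions to \<open>E'\<close> are at most \<open>E\<close> (from
    \<open>2 * w * w'\<close>), \<open>2 * E\<close> (from the term with \<open>1 - 1 / t\<close>,
    which is below 1) and \<open>\<bar>\<nu>\<bar> / a * E\<close>.\<close>
  define K where "K = 3 + \<bar>\<nu>\<bar> / a"
  define E where "E t = (w t)\<^sup>2 + (w' t)\<^sup>2" for t
  define F where "F t = E t * exp (- K * t)" for t
  have F: "\<exists>y. DERIV F t :> y \<and> y \<le> 0" if "a \<le> t" for t
  proof (intro exI conjI)
    have t: "t > 0" using a that by simp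
    show "(F has_real_derivative
        exp (- K * t) * (2 * w t * w' t + 2 * w' t * w'' t - K * E t)) (at t)"
      unfolding F_def E_def
      by (rule derivative_eq_intros refl w t)+ (simp add: algebra_simps power2_eq_square)
    have "t * w'' t = (t - 1) * w' t - \<nu> * w t"
      using w(3)[OF t] by (simp add: algebra_simps)
    then have "w'' t = ((t - 1) * w' t - \<nu> * w t) / t"
      using t by (simp add: eq_divide_eq mult.commute)
    also have "\<dots> = (1 - 1 / t) * w' t - \<nu> / t * w t"
      using t by (simp add: field_simps)
    finally have "2 * w' t * w'' t = 2 * (1 - 1 / t) * (w' t)\<^sup>2 - \<nu> / t * (2 * w t * w' t)"
      by (simp only:) (simp add: algebra_simps power2_eq_square)
    moreover have "2 * (1 - 1 / t) * (w' t)\<^sup>2 \<le> 2 * E t"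
    proof -
      have "2 * (1 - 1 / t) * (w' t)\<^sup>2 \<le> 2 * (w' t)\<^sup>2"
        using t by (intro mult_right_mono) auto
      also have "\<dots> \<le> 2 * E t"
        by (simp add: E_def)
      finally show ?thesis .
    qed
    \<comment> \<open>Both signs come from the squares of \<open>w t + w' t\<close> and
      \<open>w t - w' t\<close> being nonnegative.\<close>
    moreover have ab: "\<bar>2 * w t * w' t\<bar> \<le> E t"
      using sum_squares_bound[of "w t" "w' t"] sum_squares_bound[of "w t" "- w' t"]
      by (simp add: E_def abs_le_iff)
    moreover have "- (\<nu> / t * (2 * w t * w' t)) \<le> \<bar>\<nu>\<bar> / a * E t"
    proof -
      have "- (\<nu> / t * (2 * w t * w' t)) \<le> \<bar>\<nu> / t\<bar> * \<bar>2 * w t * w' t\<bar>"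
        by (simp only: abs_mult[symmetric] abs_ge_minus_self)
      also have "\<dots> \<le> \<bar>\<nu>\<bar> / a * E t"
        using ab a that t by (intro mult_mono) (auto intro!: divide_left_mono)
      finally show ?thesis .
    qed
    ultimately have "2 * w t * w' t + 2 * w' t * w'' t - K * E t \<le> 0"
      by (simp add: K_def algebra_simps)
    then show "exp (- K * t) * (2 * w t * w' t + 2 * w' t * w'' t - K * E t) \<le> 0"
      by (intro mult_nonneg_nonpos) simp_all
  qed
  have "F T \<le> F a"
    by (rule DERIV_nonpos_imp_nonincreasing[OF \<open>a \<le> T\<close>]) (rule F)
  then have "E T \<le> 0"
    using a by (simp add: F_def E_def mult_le_0_iff)
  then show "w T = 0"
    by (simp add: E_def sum_power2_le_zero_iff)
qed

text \<open>Equality near 0 makes the Cauchy data of \<open>u - v\<close> vanish at a small positive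
  point, from which the zero solution is continued to the right.\<close>

lemma laguerre_regular_solution_unique:
  fixes u v u' v' u'' v'' :: "real \<Rightarrow> real" and \<nu> c :: real
  assumes u: "\<And>t. t > 0 \<Longrightarrow> (u has_real_derivative u' t) (at t)"
      "\<And>t. t > 0 \<Longrightarrow> (u' has_real_derivative u'' t) (at t)"
      "\<And>t. t > 0 \<Longrightarrow> t * u'' t + (1 - t) * u' t + \<nu> * u t = 0"
    and v: "\<And>t. t > 0 \<Longrightarrow> (v has_real_derivative v' t) (at t)"
      "\<And>t. t > 0 \<Longrightarrow> (v' has_real_derivative v'' t) (at t)"
      "\<And>t. t > 0 \<Longrightarrow> t * v'' t + (1 - t) * v' t + \<nu> * v t = 0"
    and lim: "(u \<longlongrightarrow> c) (at_right 0)" "(v \<longlongrightarrow> c) (at_right 0)" "c \<noteq> 0"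
    and "T > 0"
  shows "u T = v T"
proof -
  obtain \<delta> where \<delta>: "\<delta> > 0" "\<And>t. 0 < t \<Longrightarrow> t < \<delta> \<Longrightarrow> u t = v t"
    using laguerre_eq_near_0[OF u v lim] by auto
  define a where "a = \<delta> / 2"
  have a: "0 < a" "a < \<delta>" using \<delta> by (auto simp: a_def)
  show ?thesis
  proof (cases "T < \<delta>")
    case True
    then show ?thesis using \<delta> \<open>T > 0\<close> by simp
  next
    case False
    \<comment> \<open>The functions agree on a whole neighbourhood of \<open>a\<close>, hence so do
      their derivatives there.\<close>
    have "(v has_real_derivative u' a) (at a)"
      by (rule has_field_derivative_transform_within_open[OF u(1)[OF a(1)], of "{0<..<\<delta>}"])
        (use a \<delta> in auto)
    then have a': "u' a = v' a"
      using v(1)[OF a(1)] DERIV_unique by blast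
    have "u T - v T = 0"
    proof (rule laguerre_zero_continuation[where w = "\<lambda>t. u t - v t"])
      show "((\<lambda>t. u t - v t) has_real_derivative u' t - v' t) (at t)"
        "((\<lambda>t. u' t - v' t) has_real_derivative u'' t - v'' t) (at t)" if "t > 0" for t
        using that by (auto intro!: derivative_intros u v)
      show "t * (u'' t - v'' t) + (1 - t) * (u' t - v' t) + \<nu> * (u t - v t) = 0" if "t > 0" for t
        using u(3)[OF that] v(3)[OF that] by (simp add: algebra_simps)
      show "a > 0" "u a - v a = 0" "u' a - v' a = 0" "a \<le> T"
        using a \<delta> a' False by auto
    qed
    then show ?thesis by simp
  qed
qed

section \<open>Existence of conformable Laplace transforms of polynomials in t\<close>

lemma exp_times_poly_tendsto_0:
  fixes R :: "real poly"
  assumes "s > 0"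
  shows "((\<lambda>t. exp (- s * t) * poly R t) \<longlongrightarrow> 0) at_top"
proof -
  have "((\<lambda>t. exp (- s * t) * t ^ i) \<longlongrightarrow> 0) at_top" for i
  proof -
    have "filterlim (\<lambda>t. s * t) at_top at_top"
      using assms by (intro filterlim_tendsto_pos_mult_at_top[OF tendsto_const]) (auto simp: filterlim_ident)
    then have "((\<lambda>t. (s * t) ^ i / exp (s * t)) \<longlongrightarrow> 0) at_top"
      by (rule filterlim_compose[OF tendsto_power_div_exp_0])
    then have "((\<lambda>t. (1 / s ^ i) * ((s * t) ^ i / exp (s * t))) \<longlongrightarrow> (1 / s ^ i) * 0) at_top"
      by (intro tendsto_intros)
    then show ?thesis
      using assms by (simp add: power_mult_distrib exp_minus field_simps)
  qed
  then have "((\<lambda>t. \<Sum>i\<le>degree R. coeff R i * (exp (- s * t) * t ^ i)) \<longlongrightarrow>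
      (\<Sum>i\<le>degree R. coeff R i * 0)) at_top"
    by (intro tendsto_intros)
  then show ?thesis
    by (simp add: poly_altdef sum_distrib_left mult_ac)
qed

text \<open>The derivative of \<open>exp (- s * t) * poly R t\<close> is
  \<open>exp (- s * t) * poly (pderiv R - smult s R) t\<close>. Such an \<open>R\<close> thus gives
  an elementary antiderivative of \<open>exp (- s * t) * t ^ k\<close>; the induction is repeated
  integration by parts.\<close>

lemma exp_times_monom_antiderivative:
  fixes s :: real
  assumes "s \<noteq> 0"
  shows "\<exists>R. pderiv R - smult s R = monom 1 k"
proof (induction k)
  case 0
  show ?case
    by (rule exI[of _ "[:- 1 / s:]"]) (use assms in \<open>simp add: monom_0\<close>)
next
  case (Suc k)
  then obtain R where R: "pderiv R - smult s R = monom 1 k" by blast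
  define Q where "Q = smult (real (Suc k) / s) R - monom (1 / s) (Suc k)"
  have "pderiv Q - smult s Q =
      smult (real (Suc k) / s) (pderiv R - smult s R) - monom (real (Suc k) / s) k + monom 1 (Suc k)"
    using assms
    by (simp add: Q_def pderiv_diff pderiv_smult pderiv_monom smult_diff_right smult_monom mult_ac
        del: of_nat_Suc)
  also have "\<dots> = monom 1 (Suc k)"
    by (simp add: R smult_monom)
  finally show ?case by blast
qed

text \<open>By linearity it suffices to treat powers of \<open>x powr \<alpha> / \<alpha>\<close>.
  Their integrands are nonnegative and have an explicit antiderivative with finite limits at 0 and
  at infinity.\<close>

lemma conf_laplace_exists_poly:
  assumes "\<alpha> > 0" "s > 0" and f: "\<And>x. x > 0 \<Longrightarrow> f x = poly q (x powr \<alpha> / \<alpha>)"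
  shows "conf_laplace_exists \<alpha> f s"
proof -
  define h where "h k x = exp (- s * (x powr \<alpha> / \<alpha>)) * (x powr \<alpha> / \<alpha>) ^ k * x powr (\<alpha> - 1)"
    for k :: nat and x :: real
  have h: "h k integrable_on {0<..}" for k
  proof -
    obtain R where R: "pderiv R - smult s R = monom 1 k"
      using exp_times_monom_antiderivative[of s k] \<open>s > 0\<close> by auto
    define F where "F x = exp (- s * (x powr \<alpha> / \<alpha>)) * poly R (x powr \<alpha> / \<alpha>)" for x
    have top: "filterlim (\<lambda>x. x powr \<alpha> / \<alpha>) at_top at_top"
    proof -
      have "filterlim (\<lambda>x. (1 / \<alpha>) * exp (\<alpha> * ln x)) at_top at_top"
        using \<open>\<alpha> > 0\<close>
        by (intro filterlim_tendsto_pos_mult_at_top[OF tendsto_const] filterlim_compose[OF exp_at_top]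
            ln_at_top) auto
      moreover have eq: "\<forall>\<^sub>F x in at_top. (1 / \<alpha>) * exp (\<alpha> * ln x) = x powr \<alpha> / \<alpha>"
        using eventually_gt_at_top[of 0] by eventually_elim (simp add: powr_def)
      ultimately show ?thesis
        by (simp only: filterlim_cong[OF refl refl eq])
    qed
    \<comment> \<open>For a nonnegative integrand the improper fundamental theorem yields
      integrability itself. The limits of \<open>F\<close> are \<open>poly R 0\<close> at 0 and 0 at
      infinity.\<close>
    have "set_integrable lborel (einterval (ereal 0) \<infinity>) (h k)"
    proof (rule interval_integral_FTC_nonneg)
      fix x assume "ereal 0 < ereal x"
      then have x: "x > 0" by simp
      have "((\<lambda>t. exp (- s * t) * poly R t) has_real_derivative exp (- s * t) * t ^ k) (at t)" for t
      proof -
        have "((\<lambda>t. exp (- s * t) * poly R t) has_real_derivative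
            exp (- s * t) * poly (pderiv R - smult s R) t) (at t)"
          by (auto intro!: derivative_eq_intros simp: algebra_simps)
        then show ?thesis by (simp add: R poly_monom)
      qed
      moreover have "((\<lambda>x. x powr \<alpha> / \<alpha>) has_real_derivative x powr (\<alpha> - 1)) (at x)"
        using assms x by (auto intro!: derivative_eq_intros has_real_derivative_powr)
      ultimately show "(F has_real_derivative h k x) (at x)"
        unfolding F_def h_def by (rule DERIV_chain2)
      show "isCont (h k) x"
        unfolding h_def using x assms by (intro continuous_intros) auto
    next
      show "AE x in lborel. ereal 0 < ereal x \<longrightarrow> ereal x < \<infinity> \<longrightarrow> 0 \<le> h k x"
        using assms by (intro AE_I2) (auto simp: h_def)
      have z: "((\<lambda>x. x powr \<alpha> / \<alpha>) \<longlongrightarrow> 0) (at_right 0)"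
        using assms by (auto intro!: tendsto_eq_intros tendsto_powr' simp: eventually_at_right_field
          intro: exI[of _ 1])
      have "(F \<longlongrightarrow> exp (- s * 0) * poly R 0) (at_right 0)"
        unfolding F_def by (intro tendsto_intros z)
      then show "((F \<circ> real_of_ereal) \<longlongrightarrow> exp (- s * 0) * poly R 0) (at_right (ereal 0))"
        unfolding ereal_tendsto_simps .
      show "((F \<circ> real_of_ereal) \<longlongrightarrow> 0) (at_left \<infinity>)"
        unfolding ereal_tendsto_simps F_def
        by (rule filterlim_compose[OF exp_times_poly_tendsto_0[OF \<open>s > 0\<close>] top])
    qed simp
    then show ?thesis
      using set_borel_integral_eq_integral(1) by fastforce
  qed
  have "(\<lambda>x. \<Sum>i\<le>degree q. coeff q i * h i x) integrable_on {0<..}"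
    by (intro integrable_sum integrable_on_mult_right h) auto
  then have "(\<lambda>x. exp (- s * x powr \<alpha> / \<alpha>) * f x * x powr (\<alpha> - 1)) integrable_on {0<..}"
    by (rule integrable_eq)
      (simp add: h_def f poly_altdef sum_distrib_left sum_distrib_right mult_ac)
  then show ?thesis
    \<comment> \<open>The domains \<open>{0<..}\<close> and \<open>{0..}\<close> differ by the null
      set \<open>{0}\<close>.\<close>
    unfolding conf_laplace_exists_def
    by (rule integrable_spike_set) (auto intro: negligible_subset[of "{0}"])
qed

section \<open>Laguerre polynomials\<close>

text \<open>The classical Laguerre polynomial, normalised to have value 1 at 0.\<close>

definition laguerre_poly :: "nat \<Rightarrow> real poly" where
  "laguerre_poly n = (\<Sum>k\<le>n. monom ((-1) ^ k * real (n choose k) / fact k) k)"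

lemma coeff_laguerre_poly: "coeff (laguerre_poly n) k = (-1) ^ k * real (n choose k) / fact k"
  by (simp add: laguerre_poly_def coeff_sum binomial_eq_0)

text \<open>Comparing coefficients of degree \<open>k\<close> reduces the equation to the two-term
  recurrence \<open>rec\<close>, whose right-hand factor \<open>n - k\<close> ends the series at
  \<open>n\<close>.\<close>

lemma laguerre_poly_ode:
  "pCons 0 (pderiv (pderiv (laguerre_poly n))) + [:1, -1:] * pderiv (laguerre_poly n)
    + smult (real n) (laguerre_poly n) = 0"
proof (rule poly_eqI)
  fix k
  define c where "c k = coeff (laguerre_poly n) k" for k
  have rec: "(real k + 1)\<^sup>2 * c (Suc k) = - (real n - real k) * c k" for k
  proof -
    \<comment> \<open>The difference is taken in the reals, where it is not truncated; for
      \<open>k > n\<close> both binomials are 0.\<close>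
    have "real (Suc k) * real (n choose Suc k) = (real n - real k) * real (n choose k)"
    proof (cases "k \<le> n")
      case True
      have "Suc k * (n choose Suc k) = (n - k) * (n choose k)"
        by (metis binomial_absorb_comp binomial_absorption)
      then show ?thesis
        using True by (simp flip: of_nat_mult of_nat_diff del: of_nat_Suc)
    qed (simp add: binomial_eq_0)
    moreover have "(real k + 1)\<^sup>2 * c (Suc k) =
        - ((-1) ^ k / fact k) * (real (Suc k) * real (n choose Suc k))"
      unfolding c_def coeff_laguerre_poly fact_Suc power2_eq_square
      by (simp add: add.commute)
    ultimately show ?thesis
      by (simp only: c_def coeff_laguerre_poly) (simp add: algebra_simps diff_divide_distrib)
  qed
  show "coeff (pCons 0 (pderiv (pderiv (laguerre_poly n))) + [:1, -1:] * pderiv (laguerre_poly n)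
    + smult (real n) (laguerre_poly n)) k = coeff 0 k"
    using rec[of k]
    by (cases k) (simp_all add: coeff_pderiv c_def[symmetric] algebra_simps power2_eq_square)
qed

lemma poly_laguerre_poly_ode:
  "t * poly (pderiv (pderiv (laguerre_poly n))) t + (1 - t) * poly (pderiv (laguerre_poly n)) t
    + real n * poly (laguerre_poly n) t = 0"
  using arg_cong[OF laguerre_poly_ode[of n], of "\<lambda>p. poly p t"] by (simp add: algebra_simps)

lemma poly_laguerre_poly:
  assumes "\<alpha> \<noteq> 0"
  shows "poly (laguerre_poly n) (z / \<alpha>) =
    (\<Sum>k=0..n. (-1) ^ k * (fact n / (\<alpha> ^ k * fact (n - k) * (fact k)\<^sup>2)) * z ^ k)"
  unfolding laguerre_poly_def poly_sum poly_monom atMost_atLeast0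
  by (intro sum.cong refl)
    (use assms in \<open>simp add: binomial_fact power_divide power2_eq_square field_simps\<close>)

section \<open>Solutions of the conformable equation and its transform\<close>

text \<open>In the variable \<open>t\<close> the solution \<open>y\<close> becomes a solution of
  Laguerre's equation with limit 1 at 0, as is the Laguerre polynomial.\<close>

lemma conf_laguerre_solution_unique:
  assumes \<alpha>: "\<alpha> > 0" and sol: "conf_laguerre_solution \<alpha> n y" and y0: "y 0 = 1" and "x \<ge> 0"
  shows "y x = poly (laguerre_poly n) (x powr \<alpha> / \<alpha>)"
proof (cases "x = 0")
  case True
  then show ?thesis using y0 by (simp add: poly_0_coeff_0 coeff_laguerre_poly)
next
  case False
  define X where "X t = (\<alpha> * t) powr (1 / \<alpha>)" for t
  have X: "X t > 0" "X t powr \<alpha> = \<alpha> * t" if "t > 0" for t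
    using \<alpha> that by (simp_all add: X_def powr_powr)
  have cont: "continuous_on {0..} y"
    and diff: "\<And>x. x > 0 \<Longrightarrow> conf_differentiable \<alpha> y x"
      "\<And>x. x > 0 \<Longrightarrow> conf_differentiable \<alpha> (conf_deriv \<alpha> y) x"
    and ode: "\<And>x. x > 0 \<Longrightarrow> x powr \<alpha> * conf_deriv \<alpha> (conf_deriv \<alpha> y) x
      + (\<alpha> - x powr \<alpha>) * conf_deriv \<alpha> y x + real n * \<alpha> * y x = 0"
    using sol by (auto simp: conf_laguerre_solution_def)
  define T where "T = x powr \<alpha> / \<alpha>"
  have "y (X T) = poly (laguerre_poly n) T"
  proof (rule laguerre_regular_solution_unique[where u = "\<lambda>t. y (X t)" and T = T
        and u' = "\<lambda>t. conf_deriv \<alpha> y (X t)"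
        and u'' = "\<lambda>t. conf_deriv \<alpha> (conf_deriv \<alpha> y) (X t)"
        and v' = "poly (pderiv (laguerre_poly n))"
        and v'' = "poly (pderiv (pderiv (laguerre_poly n)))"])
    show "((\<lambda>t. y (X t)) has_real_derivative conf_deriv \<alpha> y (X t)) (at t)"
      "((\<lambda>t. conf_deriv \<alpha> y (X t)) has_real_derivative conf_deriv \<alpha> (conf_deriv \<alpha> y) (X t)) (at t)"
      if "t > 0" for t
      using has_real_derivative_compose_powr_inverse[OF \<alpha> that] diff[OF X(1)[OF that]]
      unfolding X_def by auto
    show "t * conf_deriv \<alpha> (conf_deriv \<alpha> y) (X t) + (1 - t) * conf_deriv \<alpha> y (X t)
        + real n * y (X t) = 0" if "t > 0" for t
    proof -
      \<comment> \<open>Since \<open>X t powr \<alpha> = \<alpha> * t\<close>, the conformable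
        equation at \<open>X t\<close> is \<alpha> times Laguerre's equation at
        \<open>t\<close>.\<close>
      have "\<alpha> * (t * conf_deriv \<alpha> (conf_deriv \<alpha> y) (X t) + (1 - t) * conf_deriv \<alpha> y (X t)
        + real n * y (X t)) = 0"
        using ode[OF X(1)[OF that]] X(2)[OF that] by (simp add: algebra_simps)
      then show ?thesis using \<alpha> by simp
    qed
    have "(X \<longlongrightarrow> 0) (at_right 0)"
      unfolding X_def using \<alpha>
      by (auto intro!: tendsto_eq_intros tendsto_powr' simp: eventually_at_right_field
          intro: exI[of _ 1])
    \<comment> \<open>Positivity of \<open>X t\<close> keeps the approach inside
      \<open>{0..}\<close> and away from 0, so that the continuity of \<open>y\<close>
      applies.\<close>
    then have "filterlim X (at 0 within {0..}) (at_right 0)"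
      unfolding filterlim_at using X(1)
      by (auto simp: eventually_at_right_field less_imp_le order_less_imp_not_eq2 intro!: exI[of _ 1])
    moreover have "(y \<longlongrightarrow> 1) (at 0 within {0..})"
      using cont y0 by (force simp: continuous_on_def)
    ultimately show "((\<lambda>t. y (X t)) \<longlongrightarrow> 1) (at_right 0)"
      by (rule filterlim_compose[rotated])
    have "(poly (laguerre_poly n) \<longlongrightarrow> poly (laguerre_poly n) 0) (at_right 0)"
      by (intro tendsto_intros)
    then show "(poly (laguerre_poly n) \<longlongrightarrow> 1) (at_right 0)"
      by (simp add: poly_0_coeff_0 coeff_laguerre_poly)
    show "T > 0" using \<alpha> False \<open>x \<ge> 0\<close> by (simp add: T_def)
  qed (auto simp: poly_laguerre_poly_ode)
  moreover have "X T = x"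
    using \<alpha> \<open>x \<ge> 0\<close> by (simp add: X_def T_def powr_powr)
  ultimately show ?thesis by (simp add: T_def)
qed

lemma conf_deriv_poly_powr:
  assumes \<alpha>: "\<alpha> > 0" and y: "\<And>x. x \<ge> 0 \<Longrightarrow> y x = poly p (x powr \<alpha> / \<alpha>)" and "x > 0"
  shows "conf_differentiable \<alpha> y x" "conf_deriv \<alpha> y x = poly (pderiv p) (x powr \<alpha> / \<alpha>)"
    "conf_differentiable \<alpha> (conf_deriv \<alpha> y) x"
    "conf_deriv \<alpha> (conf_deriv \<alpha> y) x = poly (pderiv (pderiv p)) (x powr \<alpha> / \<alpha>)"
proof -
  \<comment> \<open>Stated for every positive point, because the second derivative needs the formula
    for the first one on a neighbourhood of \<open>x\<close>.\<close>
  have *: "conf_differentiable \<alpha> y x \<and> conf_deriv \<alpha> y x = poly (pderiv p) (x powr \<alpha> / \<alpha>)"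
    if "x > 0" for x
    using conf_deriv_of_powr_function[OF \<alpha> that poly_DERIV[of p], of y] y by auto
  then show "conf_differentiable \<alpha> y x" "conf_deriv \<alpha> y x = poly (pderiv p) (x powr \<alpha> / \<alpha>)"
    using \<open>x > 0\<close> by auto
  show "conf_differentiable \<alpha> (conf_deriv \<alpha> y) x"
    "conf_deriv \<alpha> (conf_deriv \<alpha> y) x = poly (pderiv (pderiv p)) (x powr \<alpha> / \<alpha>)"
    using conf_deriv_of_powr_function[OF \<alpha> \<open>x > 0\<close> poly_DERIV[of "pderiv p"], of "conf_deriv \<alpha> y"] *
    by auto
qed

lemma conf_laguerre_solution_poly:
  assumes \<alpha>: "\<alpha> > 0" and y: "\<And>x. x \<ge> 0 \<Longrightarrow> y x = poly (laguerre_poly n) (x powr \<alpha> / \<alpha>)"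
  shows "conf_laguerre_solution \<alpha> n y"
  unfolding conf_laguerre_solution_def
proof (intro conjI allI impI)
  have "continuous_on {0..} (\<lambda>x. poly (laguerre_poly n) (x powr \<alpha> / \<alpha>))"
    using \<alpha> by (intro continuous_intros continuous_on_powr') auto
  then show "continuous_on {0..} y"
    by (rule continuous_on_eq) (simp add: y)
  fix x :: real assume x: "x > 0"
  note d = conf_deriv_poly_powr[OF \<alpha> y x]
  show "conf_differentiable \<alpha> y x" "conf_differentiable \<alpha> (conf_deriv \<alpha> y) x"
    using d by auto
  have "x powr \<alpha> = \<alpha> * (x powr \<alpha> / \<alpha>)" using \<alpha> by simp
  then show "x powr \<alpha> * conf_deriv \<alpha> (conf_deriv \<alpha> y) x + (\<alpha> - x powr \<alpha>) * conf_deriv \<alpha> y x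
      + real n * \<alpha> * y x = 0"
    using arg_cong[OF poly_laguerre_poly_ode[of "x powr \<alpha> / \<alpha>" n], of "\<lambda>z. \<alpha> * z"] \<alpha> x
    by (simp add: d y algebra_simps)
qed

lemma conf_laguerre_transformed_poly:
  assumes \<alpha>: "\<alpha> > 0" and y: "\<And>x. x \<ge> 0 \<Longrightarrow> y x = poly (laguerre_poly n) (x powr \<alpha> / \<alpha>)"
  shows "conf_laguerre_transformed \<alpha> n y"
  unfolding conf_laguerre_transformed_def
proof (rule exI[of _ 0], intro allI impI conjI)
  fix s :: real assume s: "s > 0"
  let ?p = "laguerre_poly n"
  let ?f1 = "\<lambda>x. (\<alpha> - x powr \<alpha>) * conf_deriv \<alpha> y x"
  let ?f2 = "\<lambda>x. x powr \<alpha> * conf_deriv \<alpha> (conf_deriv \<alpha> y) x"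
  note d = conf_deriv_poly_powr[OF \<alpha> y]
  show 0: "conf_laplace_exists \<alpha> y s"
    by (rule conf_laplace_exists_poly[OF \<alpha> s, of _ ?p]) (simp add: y)
  show 1: "conf_laplace_exists \<alpha> ?f1 s"
    \<comment> \<open>With \<open>t = x powr \<alpha> / \<alpha>\<close> the coefficient is
      \<open>\<alpha> - x powr \<alpha> = \<alpha> * (1 - t)\<close>; below,
      \<open>x powr \<alpha> = \<alpha> * t\<close>.\<close>
    by (rule conf_laplace_exists_poly[OF \<alpha> s, of _ "[:\<alpha>, - \<alpha>:] * pderiv ?p"])
      (use \<alpha> in \<open>simp add: d algebra_simps\<close>)
  show 2: "conf_laplace_exists \<alpha> ?f2 s"
    by (rule conf_laplace_exists_poly[OF \<alpha> s, of _ "[:0, \<alpha>:] * pderiv (pderiv ?p)"])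
      (use \<alpha> in \<open>simp add: d\<close>)
  let ?k = "\<lambda>f x. exp (- s * x powr \<alpha> / \<alpha>) * f x * x powr (\<alpha> - 1)"
  have "((\<lambda>x. ?k ?f2 x + ?k ?f1 x + real n * \<alpha> * ?k y x) has_integral
      conf_laplace \<alpha> ?f2 s + conf_laplace \<alpha> ?f1 s + real n * \<alpha> * conf_laplace \<alpha> y s) {0..}"
    using 0 1 2 unfolding conf_laplace_exists_def conf_laplace_def
    by (intro has_integral_add has_integral_mult_right integrable_integral)
  moreover have "?k ?f2 x + ?k ?f1 x + real n * \<alpha> * ?k y x = 0" if "x \<in> {0..}" for x
  \<comment> \<open>The equation is available for \<open>x > 0\<close>. At 0 the integrand vanishes
    because \<open>0 powr (\<alpha> - 1) = 0\<close>.\<close>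
  proof (cases "x = 0")
    case False
    then have "?f2 x + ?f1 x + real n * \<alpha> * y x = 0"
      using conf_laguerre_solution_poly[OF \<alpha> y] that by (simp add: conf_laguerre_solution_def)
    then have "exp (- s * x powr \<alpha> / \<alpha>) * (?f2 x + ?f1 x + real n * \<alpha> * y x) * x powr (\<alpha> - 1) = 0"
      by simp
    then show ?thesis by (simp only: algebra_simps)
  qed simp
  ultimately show "conf_laplace \<alpha> ?f2 s + conf_laplace \<alpha> ?f1 s + real n * \<alpha> * conf_laplace \<alpha> y s = 0"
    by (metis (no_types, lifting) has_integral_is_0 has_integral_unique)
qed

theorem mainTheorem1:
  fixes \<alpha> :: real and n :: nat and y :: "real \<Rightarrow> real"
  assumes "0 < \<alpha>" and "\<alpha> \<le> 1"
  shows "(conf_laguerre_solution \<alpha> n y \<and> conf_laguerre_transformed \<alpha> n y \<and> y 0 = 1) \<longleftrightarrow>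
    (\<forall>x\<ge>0. y x = (\<Sum>k=0..n. (-1) ^ k * (fact n / (\<alpha> ^ k * fact (n - k) * (fact k)\<^sup>2)) * (x powr \<alpha>) ^ k))"
proof -
  \<comment> \<open>The equivalence is proved for the Laguerre polynomial in
    \<open>x powr \<alpha> / \<alpha>\<close>; expanding its coefficients then gives the stated
    sum.\<close>
  have "(conf_laguerre_solution \<alpha> n y \<and> conf_laguerre_transformed \<alpha> n y \<and> y 0 = 1) \<longleftrightarrow>
      (\<forall>x\<ge>0. y x = poly (laguerre_poly n) (x powr \<alpha> / \<alpha>))" (is "_ \<longleftrightarrow> ?poly")
  proof (intro iffI conjI)
    assume ?poly
    then show "conf_laguerre_solution \<alpha> n y" "conf_laguerre_transformed \<alpha> n y"
      using assms by (auto intro: conf_laguerre_solution_poly conf_laguerre_transformed_poly)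
    show "y 0 = 1"
      using \<open>?poly\<close> by (simp add: poly_0_coeff_0 coeff_laguerre_poly)
  qed (use conf_laguerre_solution_unique assms in auto)
  then show ?thesis
    using assms by (simp add: poly_laguerre_poly)
qed

end
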